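(* For $\beta>0$ and $\alpha>0$ let $N_\beta(\alpha)=\#\{(k,m)\in\mathbb{Z}_{>0}^2 : m\le \alpha\sqrt{\beta}-k\beta\}$. Then: (i) For $\beta>0$, the limit $\lim_{\alpha\to\infty}\frac{N_\beta(\alpha)-\alpha^2/2}{\alpha}$ exists if and only if $\beta$ is irrational, and whenever it exists it is strictly smaller than $-1$. (ii) The set $$\Lambda=\Big\{\beta\in\mathbb{Q}_{>0} : \limsup_{\alpha\to\infty}\frac{N_\beta(\alpha)-\alpha^2/2}{\alpha}>-1\Big\}$$ is non-empty, is contained in $[1/3,3]$, has $1$ as its unique accumulation point, and has (upper) Minkowski dimension at most $3/4$. (iii) For every finite subset $\Gamma\subset\Lambda$ there exists $\beta\in\Lambda\setminus\Gamma$ such that $$\limsup_{\alpha\to\infty}\Big(N_\beta(\alpha)-\max_{\gamma\in\Gamma}N_\gamma(\alpha)\Big)>0.$$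
   Context: $N_\beta(\alpha)$ is the number of lattice points with positive integer coordinates in the closed right triangle with vertices $(0,0)$, $(\alpha/\sqrt\beta,0)$, $(0,\alpha\sqrt\beta)$ (area $\alpha^2/2$, hypotenuse of slope $-\beta$). The Minkowski dimension of a bounded set $E\subset\mathbb{R}$ refers to the upper box-counting dimension $\limsup_{\varepsilon\to0}\log N(E,\varepsilon)/\log(1/\varepsilon)$, where $N(E,\varepsilon)$ is the minimal number of intervals of length $\varepsilon$ needed to cover $E$. *)

theory Defs
  imports "HOL-Analysis.Analysis"
begin

definition lattice_count :: "real \<Rightarrow> real \<Rightarrow> nat" where
  "lattice_count \<beta> \<alpha> =
     card {(k :: int, m :: int). k > 0 \<and> m > 0 \<and> of_int m \<le> \<alpha> * sqrt \<beta> - of_int k * \<beta>}"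

definition normalized_discrepancy :: "real \<Rightarrow> real \<Rightarrow> real" where
  "normalized_discrepancy \<beta> \<alpha> = (real (lattice_count \<beta> \<alpha>) - \<alpha>\<^sup>2 / 2) / \<alpha>"

definition Lambda_set :: "real set" where
  "Lambda_set =
     {\<beta> \<in> \<rat>. \<beta> > 0 \<and> Limsup at_top (\<lambda>\<alpha>. ereal (normalized_discrepancy \<beta> \<alpha>)) > - 1}"

text \<open>Intervals are closed and given by their left endpoints. The covering number is
  meaningful only for bounded \<open>E\<close> and positive \<open>\<epsilon>\<close>, where a finite cover exists.\<close>

definition covering_number :: "real set \<Rightarrow> real \<Rightarrow> nat" where
  "covering_number E \<epsilon> =
     (LEAST n. \<exists>C. finite C \<and> card C = n \<and> E \<subseteq> (\<Union>a\<in>C. {a..a + \<epsilon>}))"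

text \<open>For \<open>E = {}\<close> this gives the value 0, as \<open>ln 0 = 0\<close>.\<close>

definition upper_Minkowski_dim :: "real set \<Rightarrow> ereal" where
  "upper_Minkowski_dim E =
     Limsup (at_right 0) (\<lambda>\<epsilon>. ereal (ln (real (covering_number E \<epsilon>)) / ln (1 / \<epsilon>)))"

text \<open>Inserting 0 does not change the maximum for nonempty \<open>\<Gamma>\<close>, and
  makes the maximum over the empty set 0.\<close>

definition max_lattice_count :: "real set \<Rightarrow> real \<Rightarrow> nat" where
  "max_lattice_count \<Gamma> \<alpha> = Max (insert 0 ((\<lambda>\<gamma>. lattice_count \<gamma> \<alpha>) ` \<Gamma>))"

end

theory Submission
  imports Defs "HOL-Real_Asymp.Real_Asymp"
begin

text \<open>
  With \<open>T = \<alpha> * sqrt \<beta>\<close> and \<open>n = \<lfloor>T / \<beta>\<rfloor>\<close>, counting by columns gives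
  \<open>N = \<Sum>k=1..n. \<lfloor>T - k * \<beta>\<rfloor>\<close>, so up to a bounded error the discrepancy is
  \<open>- \<beta> * n / 2\<close> minus the sum of the fractional parts of \<open>T - k * \<beta>\<close>.
  For irrational \<open>\<beta>\<close> these average to \<open>1/2\<close> (compare with good rational approximations),
  giving the limit \<open>- (sqrt \<beta> + 1 / sqrt \<beta>) / 2 < - 1\<close>. For \<open>\<beta> = p / q\<close> in lowest terms
  their average is \<open>1/2 + (2 * t - 1) / (2 * q)\<close>, where \<open>t\<close> is the fractional part of
  \<open>q * sqrt \<beta> * \<alpha>\<close>; the limsup is attained at \<open>t = 0\<close>. Hence \<open>p / q\<close> lies in
  \<open>\<Lambda>\<close> iff \<open>(sqrt (p / q) - 1)\<^sup>2 < 1 / q\<close>, i.e. \<open>\<bar>sqrt p - sqrt q\<bar> < 1\<close>, from which the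
  geometry of \<open>\<Lambda>\<close> follows: there are \<open>O(Q powr (3/2))\<close> elements with denominator at
  most \<open>Q\<close>, and all others lie within \<open>O(1 / sqrt Q)\<close> of \<open>1\<close>; take \<open>Q = 1 / sqrt \<epsilon>\<close>.

  For the last part take \<open>\<beta> = 1 + 1 / n\<close> with \<open>n\<close> large and step back by slightly less than
  one period of \<open>\<beta>\<close> from a simultaneous almost-period of \<open>\<beta>\<close> and all \<open>\<gamma> \<in> \<Gamma>\<close>. There \<open>t\<close> is
  close to \<open>0\<close> for \<open>\<beta>\<close> but above \<open>1/2\<close> for every \<open>\<gamma>\<close>, whose discrepancy is therefore at
  most about \<open>- 1\<close>.
\<close>

section \<open>Sums of fractional parts\<close>

text \<open>Write \<open>real q * y\<close> as \<open>j + t\<close> with \<open>t\<close> its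
  fractional part. The terms become \<open>(r k + t) / q\<close> with
  \<open>r k = (j + k * p) mod q\<close>, and since \<open>p\<close> is invertible modulo
  \<open>q\<close>, the residues \<open>r k\<close> run through \<open>0, ..., q - 1\<close> exactly
  once.\<close>

lemma sum_frac_complete_block:
  fixes p :: int and q :: nat and y :: real
  assumes "coprime p (int q)" and "q > 0"
  shows "(\<Sum>k<q. frac (y + real k * (of_int p / real q))) = (real q - 1) / 2 + frac (real q * y)"
proof -
  define j where "j = \<lfloor>real q * y\<rfloor>"
  define t where "t = frac (real q * y)"
  define r where "r k = nat ((j + int k * p) mod int q)" for k
  have r: "real (r k) = of_int ((j + int k * p) mod int q)" for k
    using assms(2) unfolding r_def by simp
  have y: "y = (of_int j + t) / real q"
    using assms(2) unfolding j_def t_def frac_def by simp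
  have fr: "frac (y + real k * (of_int p / real q)) = (real (r k) + t) / real q" for k
  proof -
    have "j + int k * p - (j + int k * p) mod int q = ((j + int k * p) div int q) * int q"
      by (simp add: minus_mod_eq_div_mult)
    hence "real_of_int (j + int k * p) - of_int ((j + int k * p) mod int q)
        = of_int ((j + int k * p) div int q) * real q"
      by (metis of_int_diff of_int_mult of_int_of_nat_eq)
    moreover have "y + real k * (of_int p / real q) - (real (r k) + t) / real q
        = (real_of_int (j + int k * p) - of_int ((j + int k * p) mod int q)) / real q"
      by (simp add: r y add_divide_distrib diff_divide_distrib)
    ultimately have "y + real k * (of_int p / real q) - (real (r k) + t) / real q
        = of_int ((j + int k * p) div int q)"
      using assms(2) by simp
    moreover have "(j + int k * p) mod int q + 1 \<le> int q"
      using assms(2) by (simp add: zless_imp_add1_zle)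
    hence "real (r k) + 1 \<le> real q"
      unfolding r by (metis of_int_1 of_int_add of_int_le_iff of_int_of_nat_eq)
    moreover have "0 \<le> t" "t < 1"
      unfolding t_def by (simp_all add: frac_lt_1)
    ultimately show ?thesis
      unfolding frac_unique_iff using assms(2) by (simp add: field_simps)
  qed
  have "inj_on r {..<q}"
  proof (rule inj_onI)
    fix a b assume ab: "a \<in> {..<q}" "b \<in> {..<q}" "r a = r b"
    hence "(j + int a * p) mod int q = (j + int b * p) mod int q"
      by (metis r of_int_eq_iff)
    hence "int q dvd (int a - int b) * p"
      by (simp add: mod_eq_dvd_iff algebra_simps)
    hence "int q dvd int a - int b"
      using assms(1) by (simp add: coprime_commute coprime_dvd_mult_left_iff)
    hence "int a mod int q = int b mod int q"
      by (simp add: mod_eq_dvd_iff)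
    thus "a = b" using ab by (simp flip: zmod_int)
  qed
  moreover have "r ` {..<q} \<subseteq> {..<q}"
    using assms(2) by (auto simp: r_def nat_less_iff)
  ultimately have "bij_betw r {..<q} {..<q}"
    by (simp add: bij_betw_def endo_inj_surj)
  hence "(\<Sum>k<q. real (r k)) = (\<Sum>k<q. real k)"
    by (rule sum.reindex_bij_betw)
  also have "\<dots> = real q * (real q - 1) / 2"
    by (induction q) (auto simp: field_simps)
  finally have "(\<Sum>k<q. (real (r k) + t) / real q) = (real q - 1) / 2 + t"
    using assms(2) by (simp add: sum.distrib field_simps flip: sum_divide_distrib)
  thus ?thesis unfolding fr t_def .
qed

text \<open>Because \<open>frac\<close> jumps at integers, nearby points need not have nearby
  fractional parts. Within one block the points for \<delta> and for \<open>p / q\<close> differ by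
  at most \<open>1 / q\<close>; shifting the rational points by \<open>1 / q\<close> down or up
  makes the floors comparable, at a cost of \<open>2 / q\<close> per term. The shifted rational
  blocks are still complete, so their sums are within \<open>1 / 2\<close> of \<open>q / 2\<close>,
  and the total error is at most \<open>5 / 2\<close>.\<close>

lemma sum_frac_block_approx:
  fixes p :: int and q :: nat and y \<delta> :: real
  assumes "coprime p (int q)" and "q > 0" and "\<bar>\<delta> - of_int p / real q\<bar> \<le> 1 / (real q)\<^sup>2"
  shows "\<bar>\<Sum>k<q. (frac (y + real k * \<delta>) - 1 / 2)\<bar> \<le> 3"
proof -
  define u where "u k = y + real k * (of_int p / real q)" for k
  define v where "v k = y + real k * \<delta>" for k
  have uv: "\<bar>v k - u k\<bar> \<le> 1 / real q" if "k < q" for k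
  proof -
    have "\<bar>v k - u k\<bar> = real k * \<bar>\<delta> - of_int p / real q\<bar>"
      by (simp only: u_def v_def add_diff_cancel_left abs_mult abs_of_nat flip: right_diff_distrib)
    also have "\<dots> \<le> real q * (1 / (real q)\<^sup>2)"
      using that assms(3) by (intro mult_mono) auto
    finally show ?thesis using assms(2) by (simp add: power2_eq_square)
  qed
  have shift: "(\<Sum>k<q. frac (u k + c)) = (real q - 1) / 2 + frac (real q * (y + c))" for c
    using sum_frac_complete_block[OF assms(1,2), of "y + c"] by (simp add: u_def add_ac)
  have bnd: "(real q - 1) / 2 \<le> (\<Sum>k<q. frac (u k + c))" "(\<Sum>k<q. frac (u k + c)) \<le> (real q + 1) / 2" for c
    unfolding shift using frac_lt_1[of "real q * (y + c)"] frac_ge_0[of "real q * (y + c)"]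
    by (auto simp: field_simps)
  have "frac (v k) \<le> frac (u k - 1 / real q) + 2 / real q" if "k < q" for k
  proof -
    have "\<lfloor>u k - 1 / real q\<rfloor> \<le> \<lfloor>v k\<rfloor>" using uv[OF that] by (intro floor_mono) linarith
    hence "real_of_int \<lfloor>u k - 1 / real q\<rfloor> \<le> of_int \<lfloor>v k\<rfloor>" by simp
    thus ?thesis using uv[OF that] unfolding frac_def by linarith
  qed
  hence "(\<Sum>k<q. frac (v k)) \<le> (\<Sum>k<q. frac (u k + - (1 / real q)) + 2 / real q)"
    by (intro sum_mono) auto
  hence 1: "(\<Sum>k<q. frac (v k)) \<le> (real q + 1) / 2 + 2"
  proof (rule order_trans)
    have "(\<Sum>k<q. frac (u k + - (1 / real q)) + 2 / real q)
        = (\<Sum>k<q. frac (u k + - (1 / real q))) + 2"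
      using assms(2) by (simp add: sum.distrib)
    also have "\<dots> \<le> (real q + 1) / 2 + 2"
      by (intro add_right_mono bnd)
    finally show "(\<Sum>k<q. frac (u k + - (1 / real q)) + 2 / real q) \<le> (real q + 1) / 2 + 2" .
  qed
  have "frac (u k + 1 / real q) - 2 / real q \<le> frac (v k)" if "k < q" for k
  proof -
    have "\<lfloor>v k\<rfloor> \<le> \<lfloor>u k + 1 / real q\<rfloor>" using uv[OF that] by (intro floor_mono) linarith
    hence "real_of_int \<lfloor>v k\<rfloor> \<le> of_int \<lfloor>u k + 1 / real q\<rfloor>" by simp
    thus ?thesis using uv[OF that] unfolding frac_def by linarith
  qed
  hence "(\<Sum>k<q. frac (u k + 1 / real q) - 2 / real q) \<le> (\<Sum>k<q. frac (v k))"
    by (intro sum_mono) auto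
  hence 2: "(real q - 1) / 2 - 2 \<le> (\<Sum>k<q. frac (v k))"
  proof (rule order_trans[rotated])
    have "(real q - 1) / 2 - 2 \<le> (\<Sum>k<q. frac (u k + 1 / real q)) - 2"
      by (intro diff_right_mono bnd)
    also have "\<dots> = (\<Sum>k<q. frac (u k + 1 / real q) - 2 / real q)"
      using assms(2) by (simp add: sum_subtractf)
    finally show "(real q - 1) / 2 - 2 \<le> (\<Sum>k<q. frac (u k + 1 / real q) - 2 / real q)" .
  qed
  show ?thesis
    using 1 2 unfolding sum_subtractf v_def by (simp add: abs_le_iff field_simps)
qed

text \<open>Blocks of length \<open>q\<close> are removed from the end, each costing at most
  \<open>K\<close>; the fewer than \<open>q\<close> terms that remain contribute at most
  \<open>1\<close> each.\<close>

lemma sum_blocks_bound: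
  fixes g :: "nat \<Rightarrow> real"
  assumes "q > 0" and "\<And>k. \<bar>g k\<bar> \<le> 1" and "\<And>j. \<bar>\<Sum>k<q. g (j + k)\<bar> \<le> K"
  shows "\<bar>\<Sum>k<n. g k\<bar> \<le> K * (real n / real q) + real q"
proof (induction n rule: less_induct)
  case (less n)
  have K: "K \<ge> 0" using assms(3)[of 0] by linarith
  show ?case
  proof (cases "n < q")
    case True
    have "\<bar>\<Sum>k<n. g k\<bar> \<le> (\<Sum>k<n. \<bar>g k\<bar>)" by (rule sum_abs)
    also have "\<dots> \<le> (\<Sum>k<n. 1)" by (intro sum_mono assms(2))
    also have "\<dots> \<le> real q" using True by simp
    finally show ?thesis using K by (simp add: add_increasing)
  next
    case False
    define m where "m = n - q"
    have n: "n = m + q" and "m < n" using False assms(1) by (auto simp: m_def)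
    have "(\<Sum>k<n. g k) = (\<Sum>k<m. g k) + (\<Sum>k<q. g (m + k))"
      unfolding n by (induction q) (auto simp: add_ac)
    hence "\<bar>\<Sum>k<n. g k\<bar> \<le> (K * (real m / real q) + real q) + K"
      using less[OF \<open>m < n\<close>] assms(3)[of m] by linarith
    also have "\<dots> = K * (real n / real q) + real q"
      using assms(1) by (simp add: n field_simps)
    finally show ?thesis .
  qed
qed

section \<open>Asymptotics of the discrepancy\<close>

lemma lattice_count_eq_sum:
  assumes "\<beta> > 0" and "\<alpha> \<ge> 0"
  shows "real (lattice_count \<beta> \<alpha>) =
    (\<Sum>i<nat \<lfloor>\<alpha> * sqrt \<beta> / \<beta>\<rfloor>. of_int \<lfloor>\<alpha> * sqrt \<beta> - \<beta> - real i * \<beta>\<rfloor>)"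
proof -
  define T where "T = \<alpha> * sqrt \<beta>"
  define n where "n = nat \<lfloor>T / \<beta>\<rfloor>"
  have T: "T \<ge> 0" using assms by (simp add: T_def)
  have n: "i < n \<longleftrightarrow> real i + 1 \<le> T / \<beta>" for i
  proof -
    have "i < n \<longleftrightarrow> int i + 1 \<le> \<lfloor>T / \<beta>\<rfloor>" unfolding n_def by linarith
    also have "\<dots> \<longleftrightarrow> real i + 1 \<le> T / \<beta>" by (simp add: le_floor_iff)
    finally show ?thesis .
  qed
  let ?S = "SIGMA i:{..<n}. {1..\<lfloor>T - \<beta> - real i * \<beta>\<rfloor>}"
  have "{(k :: int, m :: int). k > 0 \<and> m > 0 \<and> of_int m \<le> T - of_int k * \<beta>}
      = (\<lambda>(i, m). (int i + 1, m)) ` ?S" (is "?A = _")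
  proof (rule set_eqI, safe)
    fix k m :: int
    assume km: "k > 0" "m > 0" "of_int m \<le> T - of_int k * \<beta>"
    define i where "i = nat (k - 1)"
    have k: "k = int i + 1" using km by (simp add: i_def)
    have "real_of_int m \<ge> 1" using km by simp
    hence "(real i + 1) * \<beta> \<le> T" using km unfolding k by (simp add: algebra_simps)
    hence "i < n" unfolding n using assms by (simp add: field_simps)
    moreover have "m \<le> \<lfloor>T - \<beta> - real i * \<beta>\<rfloor>"
      using km unfolding k by (simp add: le_floor_iff algebra_simps)
    ultimately show "(k, m) \<in> (\<lambda>(i, m). (int i + 1, m)) ` ?S"
      using km k by (force intro!: image_eqI[of _ _ "(i, m)"])
  next
    fix i m assume "i < n" "m \<in> {1..\<lfloor>T - \<beta> - real i * \<beta>\<rfloor>}"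
    thus "0 < int i + 1" "0 < m" "of_int m \<le> T - of_int (int i + 1) * \<beta>"
      by (auto simp: le_floor_iff algebra_simps)
  qed
  hence "lattice_count \<beta> \<alpha> = card ((\<lambda>(i, m). (int i + 1, m)) ` ?S)"
    unfolding lattice_count_def T_def by simp
  also have "\<dots> = card ?S"
    by (intro card_image) (auto simp: inj_on_def)
  also have "\<dots> = (\<Sum>i<n. nat \<lfloor>T - \<beta> - real i * \<beta>\<rfloor>)"
    by (subst card_SigmaI) auto
  finally have "real (lattice_count \<beta> \<alpha>) = (\<Sum>i<n. real (nat \<lfloor>T - \<beta> - real i * \<beta>\<rfloor>))"
    by simp
  \<comment> \<open>The truncation by \<open>nat\<close> is harmless: \<open>i < n\<close> says
    exactly that column \<open>k = i + 1\<close> has nonnegative height.\<close>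
  also have "\<dots> = (\<Sum>i<n. of_int \<lfloor>T - \<beta> - real i * \<beta>\<rfloor>)"
  proof (intro sum.cong refl)
    fix i assume "i \<in> {..<n}"
    hence "(real i + 1) * \<beta> \<le> T" using n assms by (simp add: field_simps)
    hence "0 \<le> T - \<beta> - real i * \<beta>" by (simp add: algebra_simps)
    thus "real (nat \<lfloor>T - \<beta> - real i * \<beta>\<rfloor>) = of_int \<lfloor>T - \<beta> - real i * \<beta>\<rfloor>" by simp
  qed
  finally show ?thesis unfolding n_def T_def .
qed

text \<open>Here \<open>c\<close> is the expected mean of the fractional parts and \<open>E\<close>
  bounds the accumulated deviation from it. The irrational case uses \<open>c = 1 / 2\<close>, the
  rational case the exact mean over one period.\<close>

lemma normalized_discrepancy_approx:
  assumes "\<beta> > 0" and "\<alpha> > 0" and "0 \<le> c" "c \<le> 1"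
    and "\<bar>\<Sum>i<nat \<lfloor>\<alpha> * sqrt \<beta> / \<beta>\<rfloor>. (frac (\<alpha> * sqrt \<beta> - \<beta> + real i * (- \<beta>)) - c)\<bar> \<le> E"
  shows "\<bar>normalized_discrepancy \<beta> \<alpha> + (sqrt \<beta> + 2 * c / sqrt \<beta>) / 2\<bar> \<le> (\<beta> + 1 + E) / \<alpha>"
proof -
  define T where "T = \<alpha> * sqrt \<beta>"
  define n where "n = nat \<lfloor>T / \<beta>\<rfloor>"
  define \<theta> where "\<theta> = frac (T / \<beta>)"
  have \<theta>: "0 \<le> \<theta>" "\<theta> < 1" by (simp_all add: \<theta>_def frac_lt_1)
  have "T / \<beta> \<ge> 0" using assms by (simp add: T_def)
  hence "real n = T / \<beta> - \<theta>" by (simp add: n_def \<theta>_def frac_def)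
  hence T: "T = \<beta> * (real n + \<theta>)" using assms by (simp add: field_simps)
  define \<phi> where "\<phi> i = frac (T - \<beta> + real i * (- \<beta>))" for i :: nat
  define S where "S = (\<Sum>i<n. (\<phi> i - c))"
  have S: "\<bar>S\<bar> \<le> E" using assms(5) unfolding S_def \<phi>_def n_def T_def .
  define L where "L = real (lattice_count \<beta> \<alpha>)"
  have "L = (\<Sum>i<n. of_int \<lfloor>T - \<beta> - real i * \<beta>\<rfloor>)"
    using assms unfolding L_def T_def n_def by (intro lattice_count_eq_sum) auto
  also have "\<dots> = (\<Sum>i<n. (T - \<beta> - c) - \<beta> * real i - (\<phi> i - c))"
    by (intro sum.cong) (auto simp: \<phi>_def frac_def algebra_simps)
  also have "\<dots> = real n * (T - \<beta> - c) - \<beta> * (\<Sum>i<n. real i) - S"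
    by (simp add: S_def sum.distrib sum_subtractf sum_negf sum_distrib_left algebra_simps)
  also have "(\<Sum>i<n. real i) = real n * (real n - 1) / 2"
    by (induction n) (auto simp: field_simps)
  finally have N: "L = real n * (T - \<beta> - c) - \<beta> * (real n * (real n - 1) / 2) - S" .
  define s where "s = sqrt \<beta>"
  have s: "s > 0" "\<beta> = s\<^sup>2" using assms by (auto simp: s_def)
  have \<alpha>: "\<alpha> = s * (real n + \<theta>)"
    using T s by (simp add: T_def power2_eq_square flip: s_def)
  \<comment> \<open>An exact identity: all terms growing with \<open>n\<close> cancel, leaving only
    \<open>S\<close> and terms in \<theta>, the fractional part of
    \<open>T / \<beta>\<close>.\<close>
  have "L - \<alpha>\<^sup>2 / 2 + \<alpha> * ((s + 2 * c / s) / 2)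
      = \<beta> * (\<theta> * (1 - \<theta>)) / 2 + c * \<theta> - S"
    using s(1) unfolding N T s(2) \<alpha> by (simp add: field_simps power2_eq_square)
  moreover have "0 \<le> \<beta> * (\<theta> * (1 - \<theta>))" "\<beta> * (\<theta> * (1 - \<theta>)) \<le> \<beta> * 1"
    using \<theta> assms(1) by (auto intro!: mult_nonneg_nonneg mult_left_mono mult_le_one)
  moreover have "0 \<le> c * \<theta>" "c * \<theta> \<le> 1" using \<theta> assms by (auto intro: mult_le_one)
  ultimately have *: "\<bar>L - \<alpha>\<^sup>2 / 2 + \<alpha> * ((s + 2 * c / s) / 2)\<bar> \<le> \<beta> + 1 + E"
    using S assms(1) by linarith
  have "normalized_discrepancy \<beta> \<alpha> + (s + 2 * c / s) / 2
      = (L - \<alpha>\<^sup>2 / 2 + \<alpha> * ((s + 2 * c / s) / 2)) / \<alpha>"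
    using assms(2) unfolding normalized_discrepancy_def L_def by (simp add: field_simps)
  thus ?thesis using * assms(2) by (simp add: s_def divide_right_mono)
qed

text \<open>The limit of the normalized discrepancy for \<open>\<beta> = p / q\<close> when \<open>q * sqrt \<beta> * \<alpha>\<close> has fractional part \<open>t\<close>.\<close>

definition rational_profile :: "real \<Rightarrow> nat \<Rightarrow> real \<Rightarrow> real" where
  "rational_profile \<beta> q t = - (sqrt \<beta> + (1 + (2 * t - 1) / real q) / sqrt \<beta>) / 2"

text \<open>Since \<open>q * \<beta>\<close> is an integer multiple of one, namely \<open>p\<close>,
  moving the start of a block by a multiple of \<beta> does not change the fractional part
  \<open>t\<close>. All blocks of length \<open>q\<close> thus share the mean \<open>c\<close>, full
  blocks cancel exactly (\<open>K = 0\<close>), and only an incomplete block is left, contributing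
  at most \<open>q\<close>.\<close>

lemma normalized_discrepancy_rational:
  fixes p :: int and q :: nat
  assumes "coprime p (int q)" and "q > 0" and "\<beta> = of_int p / real q" and "\<beta> > 0" and "\<alpha> > 0"
  shows "\<bar>normalized_discrepancy \<beta> \<alpha> - rational_profile \<beta> q (frac (real q * sqrt \<beta> * \<alpha>))\<bar>
    \<le> (\<beta> + 1 + real q) / \<alpha>"
proof -
  define t where "t = frac (real q * sqrt \<beta> * \<alpha>)"
  define c where "c = ((real q - 1) / 2 + t) / real q"
  define y where "y = \<alpha> * sqrt \<beta> - \<beta>"
  have t: "0 \<le> t" "t < 1" by (simp_all add: t_def frac_lt_1)
  have c: "0 \<le> c" "c \<le> 1" using t assms(2) by (auto simp: c_def field_simps)
  have frac_y: "frac (real q * (y + real j * (- \<beta>))) = t" for j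
  proof -
    have "real q * (y + real j * (- \<beta>)) = real q * sqrt \<beta> * \<alpha> - of_int ((1 + int j) * p)"
      using assms(2) by (simp add: y_def assms(3) field_simps)
    hence "real q * (y + real j * (- \<beta>)) - t = of_int (\<lfloor>real q * sqrt \<beta> * \<alpha>\<rfloor> - (1 + int j) * p)"
      unfolding t_def frac_def by simp
    thus ?thesis unfolding frac_unique_iff using t by simp
  qed
  have "(\<Sum>k<q. frac (y + real (j + k) * (- \<beta>)) - c) = 0" for j
  proof -
    have "(\<Sum>k<q. frac (y + real (j + k) * (- \<beta>)))
        = (\<Sum>k<q. frac ((y + real j * (- \<beta>)) + real k * (of_int (- p) / real q)))"
      by (intro sum.cong refl arg_cong[of _ _ frac]) (simp add: assms(3) add_divide_distrib algebra_simps)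
    also have "\<dots> = (real q - 1) / 2 + t"
      using assms(1,2) by (subst sum_frac_complete_block) (simp_all add: frac_y[simplified])
    finally show ?thesis using assms(2) by (simp add: sum_subtractf c_def)
  qed
  moreover have "\<bar>frac (y + real k * (- \<beta>)) - c\<bar> \<le> 1" for k
    using c frac_lt_1[of "y + real k * (- \<beta>)"] frac_ge_0[of "y + real k * (- \<beta>)"] by linarith
  ultimately have "\<bar>\<Sum>k<n. (frac (y + real k * (- \<beta>)) - c)\<bar> \<le> 0 * (real n / real q) + real q" for n
    using assms(2) by (intro sum_blocks_bound) simp_all
  hence "\<bar>normalized_discrepancy \<beta> \<alpha> + (sqrt \<beta> + 2 * c / sqrt \<beta>) / 2\<bar> \<le> (\<beta> + 1 + real q) / \<alpha>"
    using assms(4,5) c unfolding y_def by (intro normalized_discrepancy_approx) auto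
  moreover have "- ((sqrt \<beta> + 2 * c / sqrt \<beta>) / 2) = rational_profile \<beta> q t"
    using assms(2) by (simp add: rational_profile_def c_def add_divide_distrib diff_divide_distrib)
  ultimately show ?thesis unfolding t_def by (metis diff_minus_eq_add)
qed

lemma normalized_discrepancy_irrational:
  assumes "\<beta> > 0" and "\<beta> \<notin> \<rat>"
  shows "(normalized_discrepancy \<beta> \<longlongrightarrow> - (sqrt \<beta> + 1 / sqrt \<beta>) / 2) at_top"
proof (rule tendstoI)
  fix e :: real assume e: "e > 0"
  \<comment> \<open>At most \<open>\<alpha> / sqrt \<beta>\<close> columns occur, so an error of 3
    per block of length \<open>q\<close> contributes at most \<open>3 / (q * sqrt \<beta>)\<close>
    after division by \<alpha>. This is at most \<open>e / 2\<close> once \<open>q\<close> exceeds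
    \<open>6 / (e * sqrt \<beta>)\<close>; Dirichlet approximation supplies arbitrarily large such
    \<open>q\<close>.\<close>
  define K where "K = nat \<lceil>6 / (e * sqrt \<beta>)\<rceil> + 1"
  have K: "real K > 6 / (e * sqrt \<beta>)" unfolding K_def by linarith
  have "infinite (approx_set (- \<beta>))"
    using assms(2) by (simp flip: rational_iff_finite_approx_set)
  then obtain p h where ph: "(p, h) \<in> approx_set (- \<beta>)" "h > int K"
    using infinite_approx_set by blast
  define q where "q = nat h"
  have h: "h = int q" and q: "q > 0" "real q > real K" using ph by (auto simp: q_def)
  have pq: "coprime p (int q)" "\<bar>- \<beta> - of_int p / real q\<bar> \<le> 1 / (real q)\<^sup>2"
    using ph unfolding h approx_set_def by auto
  have blocks: "\<bar>\<Sum>k<n. (frac (y + real k * (- \<beta>)) - 1 / 2)\<bar> \<le> 3 * (real n / real q) + real q" for n y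
  proof (rule sum_blocks_bound[OF q(1)])
    fix k show "\<bar>frac (y + real k * - \<beta>) - 1 / 2\<bar> \<le> 1"
      using frac_lt_1[of "y + real k * - \<beta>"] frac_ge_0[of "y + real k * - \<beta>"] by linarith
  next
    fix j
    have "(\<Sum>k<q. frac (y + real (j + k) * - \<beta>) - 1 / 2)
        = (\<Sum>k<q. frac ((y + real j * - \<beta>) + real k * - \<beta>) - 1 / 2)"
      by (simp add: algebra_simps)
    thus "\<bar>\<Sum>k<q. frac (y + real (j + k) * - \<beta>) - 1 / 2\<bar> \<le> 3"
      using sum_frac_block_approx[OF pq(1) q(1) pq(2)] by simp
  qed
  have bound: "\<bar>normalized_discrepancy \<beta> \<alpha> + (sqrt \<beta> + 1 / sqrt \<beta>) / 2\<bar>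
      \<le> (\<beta> + 1 + real q) / \<alpha> + e / 2" if \<alpha>: "\<alpha> > 0" for \<alpha>
  proof -
    define n where "n = nat \<lfloor>\<alpha> * sqrt \<beta> / \<beta>\<rfloor>"
    have "real n \<le> \<alpha> * sqrt \<beta> / \<beta>" using assms(1) \<alpha> by (simp add: n_def)
    also have "\<dots> = \<alpha> / sqrt \<beta>" using assms(1) by (simp add: field_simps)
    finally have n: "real n \<le> \<alpha> / sqrt \<beta>" .
    have "3 * (real n / real q) / \<alpha> \<le> 3 * ((\<alpha> / sqrt \<beta>) / real q) / \<alpha>"
      using n \<alpha> by (intro divide_right_mono mult_left_mono) auto
    also have "\<dots> = (6 / sqrt \<beta>) / real q / 2" using \<alpha> by simp
    also have "6 / (e * sqrt \<beta>) < real q" using K q(2) by linarith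
    hence "(6 / sqrt \<beta>) / real q / 2 \<le> e / 2"
      using e assms(1) q(1) by (simp add: field_simps)
    finally have small: "3 * (real n / real q) / \<alpha> \<le> e / 2" .
    have "\<bar>normalized_discrepancy \<beta> \<alpha> + (sqrt \<beta> + 2 * (1 / 2) / sqrt \<beta>) / 2\<bar>
        \<le> (\<beta> + 1 + (3 * (real n / real q) + real q)) / \<alpha>"
      using assms(1) \<alpha> unfolding n_def
      by (intro normalized_discrepancy_approx blocks) auto
    also have "\<dots> = (\<beta> + 1 + real q) / \<alpha> + 3 * (real n / real q) / \<alpha>"
      by (simp add: add_divide_distrib)
    finally show ?thesis using small by simp
  qed
  have "((\<lambda>\<alpha>. (\<beta> + 1 + real q) / \<alpha>) \<longlongrightarrow> 0) at_top" by real_asymp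
  hence "eventually (\<lambda>\<alpha>. (\<beta> + 1 + real q) / \<alpha> < e / 2) at_top"
    using e by (intro order_tendstoD) auto
  thus "eventually (\<lambda>\<alpha>. dist (normalized_discrepancy \<beta> \<alpha>) (- (sqrt \<beta> + 1 / sqrt \<beta>) / 2) < e) at_top"
    using eventually_gt_at_top[of 0]
  proof eventually_elim
    case (elim \<alpha>)
    thus ?case using bound[of \<alpha>] unfolding dist_real_def by linarith
  qed
qed

lemma sqrt_plus_inverse_ge:
  assumes "\<beta> > 0" shows "sqrt \<beta> + 1 / sqrt \<beta> \<ge> 2" "\<beta> \<noteq> 1 \<Longrightarrow> sqrt \<beta> + 1 / sqrt \<beta> > 2"
proof -
  define s where "s = sqrt \<beta>"
  have s: "s > 0" using assms by (simp add: s_def)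
  have eq: "s + 1 / s - 2 = (s - 1)\<^sup>2 / s" using s by (simp add: field_simps power2_eq_square)
  have "(s - 1)\<^sup>2 / s \<ge> 0" using s by simp
  thus "sqrt \<beta> + 1 / sqrt \<beta> \<ge> 2" using eq unfolding s_def by linarith
  assume "\<beta> \<noteq> 1"
  hence "(s - 1)\<^sup>2 / s > 0" using s by (simp add: s_def)
  thus "sqrt \<beta> + 1 / sqrt \<beta> > 2" using eq unfolding s_def by linarith
qed

text \<open>The points \<open>a j\<close> are chosen so that
  \<open>q * sqrt \<beta> * a j = j + t\<close>. Every value of the profile on \<open>[0, 1)\<close>
  is therefore a subsequential limit, which refutes convergence for rational \<beta> and shows that
  the limsup is attained.\<close>

lemma normalized_discrepancy_along_frac:
  fixes p :: int and q :: nat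
  assumes "coprime p (int q)" and "q > 0" and "\<beta> = of_int p / real q" and "\<beta> > 0"
    and "0 \<le> t" "t < 1"
  defines "a \<equiv> (\<lambda>j. (real j + t) / (real q * sqrt \<beta>))"
  shows "filterlim a at_top sequentially"
    and "(\<lambda>j. normalized_discrepancy \<beta> (a j)) \<longlonglongrightarrow> rational_profile \<beta> q t"
proof -
  define s where "s = real q * sqrt \<beta>"
  have s: "s > 0" using assms by (simp add: s_def)
  have a: "a = (\<lambda>j. (real j + t) / s)" by (simp add: a_def s_def)
  show lim: "filterlim a at_top sequentially" unfolding a using s by real_asymp
  have frac_a: "frac (real q * sqrt \<beta> * a j) = t" for j
    unfolding frac_unique_iff using s assms(5,6) by (simp add: a flip: s_def)
  have ev: "eventually (\<lambda>j. norm (normalized_discrepancy \<beta> (a j) - rational_profile \<beta> q t)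
      \<le> (\<beta> + 1 + real q) / a j) sequentially"
    using filterlim_at_top_dense[THEN iffD1, OF lim, rule_format, of 0]
  proof eventually_elim
    case (elim j)
    show ?case using normalized_discrepancy_rational[OF assms(1-4) elim] by (simp add: frac_a)
  qed
  have "((\<lambda>\<alpha>. (\<beta> + 1 + real q) / \<alpha>) \<longlongrightarrow> 0) at_top" by real_asymp
  hence "(\<lambda>j. (\<beta> + 1 + real q) / a j) \<longlonglongrightarrow> 0"
    using lim by (rule filterlim_compose)
  from Lim_null_comparison[OF ev this]
  show "(\<lambda>j. normalized_discrepancy \<beta> (a j)) \<longlonglongrightarrow> rational_profile \<beta> q t"
    by (rule LIM_zero_cancel)
qed

section \<open>Existence and size of the limit\<close>

lemma normalized_discrepancy_limit_iff:
  assumes "\<beta> > 0"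
  shows "(\<exists>L::real. (normalized_discrepancy \<beta> \<longlongrightarrow> L) at_top) \<longleftrightarrow> \<beta> \<notin> \<rat>"
proof
  assume "\<exists>L::real. (normalized_discrepancy \<beta> \<longlongrightarrow> L) at_top"
  then obtain L :: real where L: "(normalized_discrepancy \<beta> \<longlongrightarrow> L) at_top" by blast
  show "\<beta> \<notin> \<rat>"
  proof
    assume "\<beta> \<in> \<rat>"
    then obtain p h where ph: "coprime p h" "h > 0" "\<beta> = of_int p / of_int h"
      by (metis Rats_cases')
    define q where "q = nat h"
    have q: "coprime p (int q)" "q > 0" "\<beta> = of_int p / real q" using ph by (auto simp: q_def)
    have "L = rational_profile \<beta> q t" if "0 \<le> t" "t < 1" for t
      using filterlim_compose[OF L normalized_discrepancy_along_frac(1)[OF q assms that]]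
        normalized_discrepancy_along_frac(2)[OF q assms that]
      by (rule LIMSEQ_unique)
    \<comment> \<open>The profile is strictly decreasing in \<open>t\<close>, so two different
      values of \<open>t\<close> give two different subsequential limits.\<close>
    from this[of 0] this[of "1/2"]
    have "rational_profile \<beta> q 0 = rational_profile \<beta> q (1/2)" by simp
    thus False using assms q(2) by (simp add: rational_profile_def)
  qed
qed (use normalized_discrepancy_irrational[OF assms] in blast)

lemma normalized_discrepancy_limit_less:
  assumes "\<beta> > 0" and "(normalized_discrepancy \<beta> \<longlongrightarrow> L) at_top"
  shows "L < - 1"
proof -
  have irr: "\<beta> \<notin> \<rat>" using assms normalized_discrepancy_limit_iff by blast
  have "L = - (sqrt \<beta> + 1 / sqrt \<beta>) / 2"
    using assms normalized_discrepancy_irrational[OF assms(1) irr]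
    by (intro tendsto_unique) auto
  \<comment> \<open>Irrationality excludes the equality case of the arithmetic-geometric mean
    inequality, which makes the bound strict.\<close>
  moreover have "\<beta> \<noteq> 1" using irr by auto
  ultimately show ?thesis using sqrt_plus_inverse_ge(2)[OF assms(1)] by simp
qed

text \<open>The profile decreases in \<open>t\<close>, so its value at \<open>t = 0\<close> bounds
  the limsup from above; the sequence with \<open>t = 0\<close> attains it.\<close>

lemma Limsup_normalized_discrepancy_rational:
  fixes p :: int and q :: nat
  assumes "coprime p (int q)" and "q > 0" and "\<beta> = of_int p / real q" and "\<beta> > 0"
  shows "Limsup at_top (\<lambda>\<alpha>. ereal (normalized_discrepancy \<beta> \<alpha>)) = ereal (rational_profile \<beta> q 0)"
proof (rule antisym)
  have mono: "rational_profile \<beta> q (frac x) \<le> rational_profile \<beta> q 0" for x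
  proof -
    have "(2 * 0 - 1) / real q \<le> (2 * frac x - 1) / real q"
      by (intro divide_right_mono) auto
    thus ?thesis
      using assms(4) unfolding rational_profile_def
      by (intro divide_right_mono le_imp_neg_le add_left_mono) auto
  qed
  have "eventually (\<lambda>\<alpha>. ereal (normalized_discrepancy \<beta> \<alpha>)
      \<le> ereal (rational_profile \<beta> q 0 + (\<beta> + 1 + real q) / \<alpha>)) at_top"
    using eventually_gt_at_top[of 0]
  proof eventually_elim
    case (elim \<alpha>)
    show ?case
      using normalized_discrepancy_rational[OF assms elim] mono[of "real q * sqrt \<beta> * \<alpha>"] by simp
  qed
  hence "Limsup at_top (\<lambda>\<alpha>. ereal (normalized_discrepancy \<beta> \<alpha>))
      \<le> Limsup at_top (\<lambda>\<alpha>. ereal (rational_profile \<beta> q 0 + (\<beta> + 1 + real q) / \<alpha>))"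
    by (rule Limsup_mono)
  also have "((\<lambda>\<alpha>. rational_profile \<beta> q 0 + (\<beta> + 1 + real q) / \<alpha>) \<longlongrightarrow> rational_profile \<beta> q 0) at_top"
    by real_asymp
  hence "Limsup at_top (\<lambda>\<alpha>. ereal (rational_profile \<beta> q 0 + (\<beta> + 1 + real q) / \<alpha>))
      = ereal (rational_profile \<beta> q 0)"
    by (intro lim_imp_Limsup) auto
  finally show "Limsup at_top (\<lambda>\<alpha>. ereal (normalized_discrepancy \<beta> \<alpha>)) \<le> ereal (rational_profile \<beta> q 0)" .
next
  define a where "a = (\<lambda>j. (real j + 0) / (real q * sqrt \<beta>))"
  have lim: "filterlim a at_top sequentially"
    "(\<lambda>j. normalized_discrepancy \<beta> (a j)) \<longlonglongrightarrow> rational_profile \<beta> q 0"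
    unfolding a_def by (rule normalized_discrepancy_along_frac[OF assms]; simp)+
  have "ereal (rational_profile \<beta> q 0) = Limsup sequentially (\<lambda>j. ereal (normalized_discrepancy \<beta> (a j)))"
    using lim(2) by (intro lim_imp_Limsup[symmetric]) auto
  also have "\<dots> \<le> Limsup (filtermap a sequentially) (\<lambda>\<alpha>. ereal (normalized_discrepancy \<beta> \<alpha>))"
    by (rule Limsup_filtermap_ge)
  \<comment> \<open>Passing to a finer filter can only lower a limsup, and \<open>a\<close> tends to
    infinity.\<close>
  also have "\<dots> \<le> Limsup at_top (\<lambda>\<alpha>. ereal (normalized_discrepancy \<beta> \<alpha>))"
    using lim(1) unfolding Limsup_def
    by (intro INF_superset_mono) (auto simp: filterlim_def le_filter_def)
  finally show "ereal (rational_profile \<beta> q 0) \<le> Limsup at_top (\<lambda>\<alpha>. ereal (normalized_discrepancy \<beta> \<alpha>))" .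
qed

section \<open>Arithmetic criterion for membership\<close>

lemma rational_profile_0_gt_iff:
  assumes "\<beta> > 0" and "q > 0"
  shows "rational_profile \<beta> q 0 > - 1 \<longleftrightarrow> (sqrt \<beta> - 1)\<^sup>2 < 1 / real q"
proof -
  define s where "s = sqrt \<beta>"
  have s: "s > 0" using assms by (simp add: s_def)
  have "rational_profile \<beta> q 0 + 1 = (1 / real q - (s - 1)\<^sup>2) / (2 * s)"
    using s assms(2) unfolding rational_profile_def s_def[symmetric]
    by (simp add: field_simps power2_eq_square)
  moreover have "(1 / real q - (s - 1)\<^sup>2) / (2 * s) > 0 \<longleftrightarrow> (s - 1)\<^sup>2 < 1 / real q"
    using s by (simp add: zero_less_divide_iff)
  ultimately show ?thesis unfolding s_def by linarith
qed

text \<open>This turns the analytic definition into an inequality in the reduced denominator,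
  equivalent to \<open>\<bar>sqrt p - sqrt q\<bar> < 1\<close>, from which the geometric facts are
  derived.\<close>

lemma mem_Lambda_set_iff:
  "\<beta> \<in> Lambda_set \<longleftrightarrow> (\<exists>(p::int) (q::nat). coprime p (int q) \<and> q > 0 \<and>
     \<beta> = of_int p / real q \<and> \<beta> > 0 \<and> (sqrt \<beta> - 1)\<^sup>2 < 1 / real q)"
proof
  assume \<beta>: "\<beta> \<in> Lambda_set"
  hence "\<beta> \<in> \<rat>" by (simp add: Lambda_set_def)
  then obtain p h where ph: "coprime p h" "h > 0" "\<beta> = of_int p / of_int h"
    by (metis Rats_cases')
  define q where "q = nat h"
  have q: "coprime p (int q)" "q > 0" "\<beta> = of_int p / real q" using ph by (auto simp: q_def)
  moreover have pos: "\<beta> > 0" using \<beta> by (simp add: Lambda_set_def)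
  moreover have "(sqrt \<beta> - 1)\<^sup>2 < 1 / real q"
    using \<beta> less_ereal.simps(1)[of "- 1"] Limsup_normalized_discrepancy_rational[OF q pos] rational_profile_0_gt_iff[OF pos q(2)]
    by (simp add: Lambda_set_def one_ereal_def del: less_ereal.simps)
  ultimately show "\<exists>(p::int) (q::nat). coprime p (int q) \<and> q > 0 \<and>
     \<beta> = of_int p / real q \<and> \<beta> > 0 \<and> (sqrt \<beta> - 1)\<^sup>2 < 1 / real q" by blast
next
  assume "\<exists>(p::int) (q::nat). coprime p (int q) \<and> q > 0 \<and>
     \<beta> = of_int p / real q \<and> \<beta> > 0 \<and> (sqrt \<beta> - 1)\<^sup>2 < 1 / real q"
  then obtain p :: int and q :: nat where pq: "coprime p (int q)" "q > 0"
    "\<beta> = of_int p / real q" "\<beta> > 0" "(sqrt \<beta> - 1)\<^sup>2 < 1 / real q" by blast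
  have "rational_profile \<beta> q 0 > - 1"
    using rational_profile_0_gt_iff[of \<beta> q] pq by blast
  thus "\<beta> \<in> Lambda_set"
    using Limsup_normalized_discrepancy_rational[OF pq(1-4)] pq(4)
    by (simp add: Lambda_set_def pq(3) one_ereal_def)
qed

section \<open>Geometry of the exceptional set\<close>

text \<open>The criterion is symmetric in numerator and denominator: dividing it by
  \<open>s\<^sup>2 = p / q\<close> replaces \<open>1 / q\<close> by \<open>1 / p\<close>. This
  symmetry yields the lower bound \<open>1 / 3\<close> from the upper bound 3.\<close>

lemma inverse_mem_Lambda_set:
  assumes "\<beta> \<in> Lambda_set" shows "1 / \<beta> \<in> Lambda_set"
proof -
  obtain p :: int and q :: nat where pq: "coprime p (int q)" "q > 0"
    "\<beta> = of_int p / real q" "\<beta> > 0" "(sqrt \<beta> - 1)\<^sup>2 < 1 / real q"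
    using assms mem_Lambda_set_iff by blast
  have p: "p > 0" using pq(2-4) by (simp add: zero_less_divide_iff)
  define s where "s = sqrt \<beta>"
  have s: "s > 0" "s\<^sup>2 = \<beta>" using pq(4) by (simp_all add: s_def)
  have "(sqrt (1 / \<beta>) - 1)\<^sup>2 = (s - 1)\<^sup>2 / s\<^sup>2"
    using s(1) by (simp add: real_sqrt_divide field_simps power2_eq_square flip: s_def)
  also have "\<dots> < (1 / real q) / s\<^sup>2"
    using pq(5) s(1) by (intro divide_strict_right_mono) (auto simp: s_def)
  also have "\<dots> = 1 / real (nat p)"
    using p pq(2) unfolding s(2) pq(3) by simp
  finally have "(sqrt (1 / \<beta>) - 1)\<^sup>2 < 1 / real (nat p)" .
  moreover have "coprime (int q) (int (nat p))" using pq(1) p by (simp add: coprime_commute)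
  moreover have "1 / \<beta> = of_int (int q) / real (nat p)" using p by (simp add: pq(3))
  moreover have "nat p > 0" "1 / \<beta> > 0" using p pq(4) by simp_all
  ultimately show ?thesis unfolding mem_Lambda_set_iff by metis
qed

lemma Lambda_set_le_3:
  assumes "\<beta> \<in> Lambda_set" shows "\<beta> \<le> 3"
proof -
  obtain p :: int and q :: nat where pq: "q > 0"
    "\<beta> = of_int p / real q" "\<beta> > 0" "(sqrt \<beta> - 1)\<^sup>2 < 1 / real q"
    using assms mem_Lambda_set_iff by blast
  define s where "s = sqrt \<beta>"
  have s: "s > 0" "s\<^sup>2 = \<beta>" using pq(3) by (simp_all add: s_def)
  show ?thesis
  proof (cases "q = 1")
    case True
    \<comment> \<open>For integers the estimate only gives a bound below 4; integrality of
      \<open>p\<close> improves it to 3.\<close>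
    hence "(s - 1)\<^sup>2 < 1\<^sup>2" using pq(4) by (simp add: s_def)
    hence "s < 2" using power2_less_imp_less[of "s - 1" 1] by simp
    hence "s\<^sup>2 < 2\<^sup>2" using s(1) by (intro power_strict_mono) auto
    hence "p < 4" using True pq(2) s(2) by simp
    thus ?thesis using True pq(2) by simp
  next
    case False
    hence "1 / real q \<le> 1 / 2" using pq(1) by (intro divide_left_mono) auto
    \<comment> \<open>The constant satisfies \<open>0.71\<^sup>2 > 1 / 2\<close> and still
      \<open>1.71\<^sup>2 < 3\<close>.\<close>
    hence "(s - 1)\<^sup>2 < 0.71\<^sup>2" using pq(4) by (simp add: s_def power2_eq_square)
    hence "s < 1.71" using power2_less_imp_less[of "s - 1" "0.71"] by simp
    hence "s\<^sup>2 < 1.71\<^sup>2" using s(1) by (intro power_strict_mono) auto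
    thus ?thesis using s(2) by (simp add: power2_eq_square)
  qed
qed

lemma Lambda_set_subset: "Lambda_set \<subseteq> {1/3..3}"
proof
  fix \<beta> assume \<beta>: "\<beta> \<in> Lambda_set"
  hence "1 / \<beta> \<le> 3" using inverse_mem_Lambda_set Lambda_set_le_3 by blast
  moreover have "\<beta> > 0" using \<beta> by (simp add: Lambda_set_def)
  ultimately show "\<beta> \<in> {1/3..3}" using Lambda_set_le_3[OF \<beta>] by (simp add: field_simps)
qed

text \<open>With \<open>s = sqrt \<beta>\<close>, the difference factors as
  \<open>(s - 1) * (s + 1)\<close>; the hypothesis bounds the first factor by
  \<open>1 / sqrt q\<close> and forces \<open>s < 2\<close>.\<close>

lemma abs_sqrt_diff_one_bound:
  assumes "\<beta> > 0" and "q > 0" and "(sqrt \<beta> - 1)\<^sup>2 < 1 / real q"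
  shows "\<bar>\<beta> - 1\<bar> < 3 / sqrt (real q)"
proof -
  define s where "s = sqrt \<beta>"
  have s: "s > 0" "s\<^sup>2 = \<beta>" using assms by (simp_all add: s_def)
  have "sqrt ((s - 1)\<^sup>2) < sqrt (1 / real q)"
    using assms(3) unfolding s_def by (rule real_sqrt_less_mono)
  hence 1: "\<bar>s - 1\<bar> < 1 / sqrt (real q)" by (simp add: real_sqrt_divide)
  have "1 / sqrt (real q) \<le> 1" using assms(2) by simp
  hence "s < 2" using 1 by linarith
  have "\<bar>\<beta> - 1\<bar> = \<bar>s - 1\<bar> * (s + 1)"
  proof -
    have "\<beta> - 1 = (s - 1) * (s + 1)" using s(2) by (simp add: algebra_simps power2_eq_square)
    thus ?thesis using s(1) by (simp add: abs_mult)
  qed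
  also have "\<dots> \<le> \<bar>s - 1\<bar> * 3" using \<open>s < 2\<close> by (intro mult_left_mono) auto
  also have "\<dots> < 1 / sqrt (real q) * 3" using 1 by simp
  finally show ?thesis by simp
qed

section \<open>Covering estimates and the Minkowski dimension\<close>

lemma Lambda_set_cover:
  assumes "Q \<ge> 1"
  obtains A where "finite A" and "real (card A) \<le> 7 * Q * sqrt Q"
    and "Lambda_set \<subseteq> A \<union> {\<beta>. \<bar>\<beta> - 1\<bar> < 3 / sqrt Q}"
proof
  define m where "m = \<lfloor>3 * sqrt Q\<rfloor>"
  define n where "n = nat \<lfloor>Q\<rfloor>"
  \<comment> \<open>Candidates with denominator at most \<open>Q\<close>, written as
    \<open>1 + d / q\<close> with \<open>d = p - q\<close>. The bound on
    \<open>\<bar>\<beta> - 1\<bar>\<close> gives \<open>\<bar>d\<bar> < 3 * sqrt q\<close>, which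
    explains the range \<open>m\<close>.\<close>
  define A where "A = (\<lambda>(q, d). 1 + of_int d / real q) ` ({1..n} \<times> {-m..m})"
  have m: "m \<ge> 0" using assms by (simp add: m_def)
  show "finite A" by (simp add: A_def)
  have "card A \<le> card ({1..n} \<times> {-m..m})" unfolding A_def by (intro card_image_le) auto
  also have "\<dots> = n * nat (2 * m + 1)" by (simp add: card_cartesian_product)
  finally have "real (card A) \<le> real (n * nat (2 * m + 1))" by (rule of_nat_mono)
  also have "\<dots> = real n * (2 * of_int m + 1)" using m by simp
  \<comment> \<open>The summand 1 is absorbed into \<open>sqrt Q\<close>, as
    \<open>Q \<ge> 1\<close>.\<close>
  also have "\<dots> \<le> Q * (2 * (3 * sqrt Q) + sqrt Q)"
  proof (intro mult_mono add_mono)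
    show "real n \<le> Q" using assms by (simp add: n_def)
    show "real_of_int m \<le> 3 * sqrt Q" by (simp add: m_def)
  qed (use assms m in auto)
  finally show "real (card A) \<le> 7 * Q * sqrt Q" by (simp add: algebra_simps)
  show "Lambda_set \<subseteq> A \<union> {\<beta>. \<bar>\<beta> - 1\<bar> < 3 / sqrt Q}"
  proof
    fix \<beta> assume "\<beta> \<in> Lambda_set"
    then obtain p :: int and q :: nat where pq: "q > 0"
      "\<beta> = of_int p / real q" "\<beta> > 0" "(sqrt \<beta> - 1)\<^sup>2 < 1 / real q"
      using mem_Lambda_set_iff by blast
    have b: "\<bar>\<beta> - 1\<bar> < 3 / sqrt (real q)" using abs_sqrt_diff_one_bound pq by blast
    show "\<beta> \<in> A \<union> {\<beta>. \<bar>\<beta> - 1\<bar> < 3 / sqrt Q}"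
    proof (cases "real q \<le> Q")
      case True
      have "real_of_int (p - int q) = real q * (\<beta> - 1)"
        using pq(1) by (simp add: pq(2) right_diff_distrib)
      hence "\<bar>real_of_int (p - int q)\<bar> = real q * \<bar>\<beta> - 1\<bar>"
        by (simp only: abs_mult abs_of_nat)
      also have "\<dots> < real q * (3 / sqrt (real q))"
        using b pq(1) by (intro mult_strict_left_mono) simp_all
      also have "\<dots> = 3 * (real q / sqrt (real q))" by simp
      also have "\<dots> = 3 * sqrt (real q)" by (simp only: real_div_sqrt of_nat_0_le_iff)
      also have "\<dots> \<le> 3 * sqrt Q" using True by simp
      finally have "\<bar>real_of_int (p - int q)\<bar> \<le> 3 * sqrt Q" by simp
      hence "\<bar>p - int q\<bar> \<le> m" unfolding m_def by (simp add: le_floor_iff)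
      moreover have "q \<le> n" using True unfolding n_def by (simp add: le_nat_floor)
      moreover have "\<beta> = 1 + of_int (p - int q) / real q" using pq(1) by (simp add: pq(2) field_simps)
      ultimately have "\<beta> \<in> A" unfolding A_def using pq(1)
        by (intro image_eqI[of _ _ "(q, p - int q)"]) auto
      thus ?thesis by simp
    next
      case False
      hence "3 / sqrt (real q) \<le> 3 / sqrt Q" using assms by (intro divide_left_mono) auto
      thus ?thesis using b by simp
    qed
  qed
qed

text \<open>The choice \<open>Q = 1 / r\<^sup>2\<close> balances the two contributions at scale
  \<open>r ^ 4\<close>: about \<open>Q powr (3/2) = 1 / r ^ 3\<close> separate points, and an
  interval of length \<open>6 * r\<close> around 1, which needs about \<open>6 / r ^ 3\<close>
  pieces. The fourth power keeps all exponents integral.\<close>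

lemma covering_number_Lambda_set:
  assumes "0 < r" and "r < 1"
  shows "real (covering_number Lambda_set (r ^ 4)) \<le> 14 / r ^ 3"
proof -
  have sqrt_r: "sqrt (1 / r\<^sup>2) = 1 / r" using assms by (simp add: real_sqrt_divide)
  have "1 / r\<^sup>2 \<ge> 1" using assms by (simp add: power_le_one)
  from Lambda_set_cover[OF this, unfolded sqrt_r]
  obtain A where A: "finite A" "real (card A) \<le> 7 * (1 / r\<^sup>2) * (1 / r)"
    "Lambda_set \<subseteq> A \<union> {\<beta>. \<bar>\<beta> - 1\<bar> < 3 / (1 / r)}" by blast
  define n where "n = nat \<lfloor>6 / r ^ 3\<rfloor>"
  define B where "B = (\<lambda>i. 1 - 3 * r + real i * r ^ 4) ` {..n}"
  have "card B \<le> card {..n}" unfolding B_def by (intro card_image_le) auto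
  hence "real (card B) \<le> real n + 1" by simp
  also have "real n \<le> 6 / r ^ 3" using assms by (simp add: n_def)
  also have "1 \<le> 1 / r ^ 3" using assms by (simp add: power_le_one)
  finally have B: "real (card B) \<le> 7 / r ^ 3" by simp
  have "Lambda_set \<subseteq> (\<Union>a\<in>A \<union> B. {a..a + r ^ 4})"
  proof
    fix x assume "x \<in> Lambda_set"
    then consider "x \<in> A" | "\<bar>x - 1\<bar> < 3 * r" using A(3) by auto
    thus "x \<in> (\<Union>a\<in>A \<union> B. {a..a + r ^ 4})"
    proof cases
      case 1
      thus ?thesis using assms by force
    next
      case 2
      define u where "u = (x - 1 + 3 * r) / r ^ 4"
      have u0: "u \<ge> 0" using 2 assms by (simp add: u_def)
      have "u \<le> 6 * r / r ^ 4" unfolding u_def using 2 assms by (intro divide_right_mono) auto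
      also have "\<dots> = 6 / r ^ 3" using assms by (simp add: power_eq_if field_simps)
      finally have "nat \<lfloor>u\<rfloor> \<le> n" unfolding n_def by (intro nat_mono floor_mono)
      moreover have "x = 1 - 3 * r + u * r ^ 4" using assms by (simp add: u_def)
      moreover have "real (nat \<lfloor>u\<rfloor>) * r ^ 4 \<le> u * r ^ 4" "u * r ^ 4 \<le> (real (nat \<lfloor>u\<rfloor>) + 1) * r ^ 4"
        using u0 assms by (auto intro!: mult_right_mono)
      ultimately show ?thesis
        unfolding B_def by (intro UN_I[of "1 - 3 * r + real (nat \<lfloor>u\<rfloor>) * r ^ 4"]) (auto simp: algebra_simps)
    qed
  qed
  hence "covering_number Lambda_set (r ^ 4) \<le> card (A \<union> B)"
    unfolding covering_number_def using A(1) by (intro Least_le exI[of _ "A \<union> B"]) (auto simp: B_def)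
  also have "\<dots> \<le> card A + card B" by (rule card_Un_le)
  finally have "real (covering_number Lambda_set (r ^ 4)) \<le> real (card A) + real (card B)"
    by (metis of_nat_add of_nat_mono)
  also have "\<dots> \<le> 7 / r ^ 3 + 7 / r ^ 3"
    using A(2) B by (intro add_mono) (simp_all add: power_eq_if mult_ac)
  finally show ?thesis by simp
qed

lemma upper_Minkowski_dim_Lambda_set: "upper_Minkowski_dim Lambda_set \<le> ereal (3/4)"
proof -
  have "eventually (\<lambda>\<epsilon>. ereal (ln (real (covering_number Lambda_set \<epsilon>)) / ln (1 / \<epsilon>))
      \<le> ereal (ln 14 / ln (1 / \<epsilon>) + 3 / 4)) (at_right 0)"
    using eventually_at_right_less[of "0::real"] eventually_at_right_real[of 0 1, simplified]
  proof eventually_elim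
    case (elim \<epsilon>)
    define r where "r = sqrt (sqrt \<epsilon>)"
    have r: "0 < r" "r < 1" using elim by (simp_all add: r_def)
    have \<epsilon>: "\<epsilon> = r ^ 4"
    proof -
      have "r ^ 4 = (r\<^sup>2)\<^sup>2" by simp
      thus ?thesis using elim by (simp add: r_def del: power2_eq_iff)
    qed
    have ln_\<epsilon>: "ln (1 / \<epsilon>) = - 4 * ln r" unfolding \<epsilon> using r by (simp add: ln_div ln_realpow)
    have ln_r: "ln r < 0" using r by simp
    \<comment> \<open>Needed for the formal case of covering number 0, where \<open>ln 0 = 0\<close>
      must lie below the logarithm of the bound.\<close>
    have "1 \<le> 14 / r ^ 3" using r power_le_one[of r 3] by (simp add: field_simps)
    hence "ln (real (covering_number Lambda_set \<epsilon>)) \<le> ln (14 / r ^ 3)"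
      using covering_number_Lambda_set[OF r] unfolding \<epsilon>
      by (cases "covering_number Lambda_set (r ^ 4) = 0") (auto intro: ln_mono)
    also have "\<dots> = ln 14 - 3 * ln r" using r by (simp add: ln_div ln_realpow)
    finally have "ln (real (covering_number Lambda_set \<epsilon>)) / ln (1 / \<epsilon>) \<le> (ln 14 - 3 * ln r) / (- 4 * ln r)"
      unfolding ln_\<epsilon> using ln_r by (intro divide_right_mono) auto
    also have "\<dots> = ln 14 / ln (1 / \<epsilon>) + 3 / 4"
      unfolding ln_\<epsilon> using ln_r by (simp add: field_simps)
    finally show ?case by simp
  qed
  hence "upper_Minkowski_dim Lambda_set \<le> Limsup (at_right 0) (\<lambda>\<epsilon>. ereal (ln 14 / ln (1 / \<epsilon>) + 3 / 4))"
    unfolding upper_Minkowski_dim_def by (rule Limsup_mono)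
  also have "((\<lambda>\<epsilon>::real. ln 14 / ln (1 / \<epsilon>) + 3 / 4) \<longlongrightarrow> 3 / 4) (at_right 0)"
    by real_asymp
  hence "Limsup (at_right 0) (\<lambda>\<epsilon>. ereal (ln 14 / ln (1 / \<epsilon>) + 3 / 4)) = ereal (3 / 4)"
    by (intro lim_imp_Limsup) auto
  finally show ?thesis .
qed

section \<open>Accumulation points\<close>

lemma sqrt_one_plus_inverse_close:
  fixes x :: real
  assumes "x > 0" shows "(sqrt (1 + 1 / x) - 1)\<^sup>2 < 1 / x"
proof -
  define s where "s = sqrt (1 + 1 / x)"
  have s: "s\<^sup>2 = 1 + 1 / x" "s > 1" using assms by (simp_all add: s_def add_nonneg_nonneg)
  have "(s - 1) * (s - 1) < (s - 1) * (s + 1)" using s(2) by (intro mult_strict_left_mono) auto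
  also have "\<dots> = 1 / x" using s(1) by (simp add: algebra_simps power2_eq_square)
  finally show ?thesis by (simp add: power2_eq_square s_def)
qed

lemma one_plus_inverse_mem_Lambda_set:
  assumes "n > 0" shows "1 + 1 / real n \<in> Lambda_set"
proof -
  have "coprime (int n + 1) (int n)" by (simp add: coprime_commute)
  moreover have "1 + 1 / real n = of_int (int n + 1) / real n" using assms by (simp add: field_simps)
  moreover have "1 + 1 / real n > 0" by (simp add: add_pos_nonneg)
  ultimately show ?thesis
    using assms sqrt_one_plus_inverse_close[of "real n"] unfolding mem_Lambda_set_iff
    by (intro exI[of _ "int n + 1"] exI[of _ n] conjI; simp only: of_nat_0_less_iff)
qed

lemma islimpt_Lambda_set_iff: "x islimpt Lambda_set \<longleftrightarrow> x = 1"
proof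
  assume lim: "x islimpt Lambda_set"
  show "x = 1"
  proof (rule ccontr)
    assume "x \<noteq> 1"
    define e where "e = \<bar>x - 1\<bar> / 2"
    have e: "e > 0" using \<open>x \<noteq> 1\<close> by (simp add: e_def)
    \<comment> \<open>With \<open>Q = 1 + (3 / e)\<^sup>2\<close> one has \<open>Q \<ge> 1\<close>
      and \<open>3 / sqrt Q \<le> e\<close>, whereas points of \<open>ball x e\<close> are farther
      than \<open>e\<close> from 1. Hence only the finite set \<open>A\<close> can meet the
      ball.\<close>
    obtain A where A: "finite A" "Lambda_set \<subseteq> A \<union> {\<beta>. \<bar>\<beta> - 1\<bar> < 3 / sqrt (1 + (3 / e)\<^sup>2)}"
      using Lambda_set_cover[of "1 + (3 / e)\<^sup>2"] by auto
    have "3 / e \<le> sqrt (1 + (3 / e)\<^sup>2)" by (rule real_le_rsqrt) simp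
    hence "3 \<le> e * sqrt (1 + (3 / e)\<^sup>2)" using e by (simp only: pos_divide_le_eq mult.commute)
    moreover have "sqrt (1 + (3 / e)\<^sup>2) > 0" by (simp add: add_pos_nonneg)
    ultimately have "3 / sqrt (1 + (3 / e)\<^sup>2) \<le> e" by (simp only: pos_divide_le_eq)
    moreover have "e < \<bar>\<beta> - 1\<bar>" if "\<beta> \<in> ball x e" for \<beta>
    proof -
      have "\<bar>x - \<beta>\<bar> < e" using that by (simp add: dist_real_def)
      moreover have "\<bar>x - 1\<bar> = 2 * e" by (simp add: e_def)
      ultimately show ?thesis by linarith
    qed
    ultimately have "Lambda_set \<inter> ball x e \<subseteq> A" using A(2) by fastforce
    hence "finite (Lambda_set \<inter> ball x e)" using A(1) finite_subset by blast
    thus False using lim e by (simp add: islimpt_eq_infinite_ball)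
  qed
next
  assume "x = 1"
  have "1 islimpt Lambda_set"
    unfolding islimpt_approachable
  proof (intro allI impI)
    fix e :: real assume "e > 0"
    then obtain n :: nat where "n > 0" "1 / real n < e"
      by (metis nat_approx_posE zero_less_Suc)
    thus "\<exists>x'\<in>Lambda_set. x' \<noteq> 1 \<and> dist x' 1 < e"
      using one_plus_inverse_mem_Lambda_set by (intro bexI[of _ "1 + 1 / real n"]) (auto simp: dist_real_def)
  qed
  thus "x islimpt Lambda_set" using \<open>x = 1\<close> by simp
qed

section \<open>New maximizers\<close>

lemma simultaneous_recurrence:
  fixes S :: "real set" and \<epsilon> B :: real
  assumes "finite S" and "\<epsilon> > 0"
  obtains A where "A \<ge> B" and "\<And>s. s \<in> S \<Longrightarrow> \<exists>z::int. \<bar>A * s - of_int z\<bar> < \<epsilon>"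
proof -
  obtain h where h: "bij_betw h {0..<card S} S"
    using ex_bij_betw_nat_finite[OF assms(1)] by blast
  \<comment> \<open>Dirichlet's theorem is applied to the numbers \<open>B' * s\<close>, so that the
    common multiplier is \<open>q * B'\<close> with \<open>q \<ge> 1\<close> and automatically
    exceeds the prescribed bound.\<close>
  define B' where "B' = max 1 B"
  obtain N :: nat where N: "N > 0" "1 / real N < \<epsilon>"
    using assms(2) by (metis nat_approx_posE zero_less_Suc)
  obtain q p where q: "0 < q"
    and p: "\<And>i. i < card S \<Longrightarrow> \<bar>of_int q * (B' * h i) - of_int (p i)\<bar> < 1 / real N"
    using Dirichlet_approx_simult[OF N(1), where n = "card S" and \<theta> = "\<lambda>i. B' * h i"] by blast
  show ?thesis
  proof
    have "1 * B' \<le> of_int q * B'" using q by (intro mult_right_mono) (auto simp: B'_def)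
    thus "of_int q * B' \<ge> B" by (simp add: B'_def)
    fix s assume "s \<in> S"
    then obtain i where i: "i < card S" "h i = s"
      using bij_betw_imp_surj_on[OF h] by (metis atLeastLessThan_iff imageE)
    show "\<exists>z::int. \<bar>of_int q * B' * s - of_int z\<bar> < \<epsilon>"
      using p[OF i(1)] N(2) by (intro exI[of _ "p i"]) (simp add: i(2) mult.assoc)
  qed
qed

text \<open>Start at an almost-period \<open>A\<close> of all frequencies and step back by \<eta>.
  Modulo 1, \<open>\<sigma> * \<eta>\<close> equals \<open>- \<delta>\<close>, so the phase of
  \<sigma> lands near \<delta>. A frequency \<open>s \<le> \<sigma> / 4\<close> moves back by at
  most \<open>1 / 4\<close>, so its phase lands just below an integer and its fractional part is at
  least \<open>1 / 2\<close>.\<close>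

lemma simultaneous_frac_control:
  fixes S :: "real set" and \<sigma> \<delta> B :: real
  assumes "finite S" and "\<And>s. s \<in> S \<Longrightarrow> 0 < s" and "\<And>s. s \<in> S \<Longrightarrow> 4 * s \<le> \<sigma>"
    and "\<sigma> > 0" and "0 < \<delta>" "\<delta> < 1 / 2"
  obtains \<alpha> where "\<alpha> \<ge> B" and "\<And>s. s \<in> S \<Longrightarrow> frac (s * \<alpha>) \<ge> 1 / 2" and "frac (\<sigma> * \<alpha>) \<le> 2 * \<delta>"
proof -
  define \<eta> where "\<eta> = (1 - \<delta>) / \<sigma>"
  have \<eta>: "\<eta> > 0" "\<eta> * \<sigma> = 1 - \<delta>" using assms(4-6) by (auto simp: \<eta>_def)
  \<comment> \<open>The three kinds of bounds keep the fractional parts of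
    \<open>s * \<alpha>\<close> above \<open>1 / 2\<close>, keep that of
    \<open>\<sigma> * \<alpha>\<close> in \<open>[0, 2 * \<delta>]\<close>, and prevent
    \<open>s * \<alpha>\<close> from crossing the integer above it.\<close>
  define \<epsilon> where "\<epsilon> = Min ({1 / 4, \<delta>} \<union> (\<lambda>s. \<eta> * s) ` S)"
  have fin: "finite ({1 / 4, \<delta>} \<union> (\<lambda>s. \<eta> * s) ` S)" using assms(1) by simp
  have \<epsilon>: "\<epsilon> > 0" unfolding \<epsilon>_def using assms(2,5) \<eta>(1) fin by (subst Min_gr_iff) auto
  have \<epsilon>_le: "\<epsilon> \<le> 1 / 4" "\<epsilon> \<le> \<delta>" "\<And>s. s \<in> S \<Longrightarrow> \<epsilon> \<le> \<eta> * s"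
    unfolding \<epsilon>_def by (rule Min_le[OF fin]; blast)+
  obtain A where A: "A \<ge> B + \<eta>" "\<And>s. s \<in> insert \<sigma> S \<Longrightarrow> \<exists>z::int. \<bar>A * s - of_int z\<bar> < \<epsilon>"
    using simultaneous_recurrence[of "insert \<sigma> S" \<epsilon>] assms(1) \<epsilon> by (metis finite_insert)
  show ?thesis
  proof
    show "A - \<eta> \<ge> B" using A(1) by simp
  next
    fix s assume s: "s \<in> S"
    then obtain z :: int where z: "\<bar>A * s - of_int z\<bar> < \<epsilon>" using A(2) by blast
    have "\<eta> * s \<le> \<eta> * (\<sigma> / 4)" using \<eta>(1) assms(3)[OF s] by (intro mult_left_mono) auto
    hence "\<eta> * s \<le> 1 / 4" using \<eta>(2) assms(5) by simp
    have "s * (A - \<eta>) - (A * s - of_int z - \<eta> * s + 1) = of_int (z - 1)"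
      by (simp add: algebra_simps)
    hence "frac (s * (A - \<eta>)) = A * s - of_int z - \<eta> * s + 1"
      using \<open>\<eta> * s \<le> 1 / 4\<close> z \<epsilon>_le(1) \<epsilon>_le(3)[OF s]
      unfolding frac_unique_iff by (auto simp del: of_int_diff)
    thus "frac (s * (A - \<eta>)) \<ge> 1 / 2"
      using \<open>\<eta> * s \<le> 1 / 4\<close> z \<epsilon>_le(1) by linarith
  next
    obtain z :: int where z: "\<bar>A * \<sigma> - of_int z\<bar> < \<epsilon>" using A(2) by blast
    have "\<sigma> * (A - \<eta>) - (A * \<sigma> - of_int z + \<delta>) = of_int (z - 1)"
      using \<eta>(2) by (simp add: algebra_simps)
    hence "frac (\<sigma> * (A - \<eta>)) = A * \<sigma> - of_int z + \<delta>"
      using z \<epsilon>_le(2) assms(6) unfolding frac_unique_iff by (auto simp del: of_int_diff)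
    thus "frac (\<sigma> * (A - \<eta>)) \<le> 2 * \<delta>" using z \<epsilon>_le(2) by linarith
  qed
qed

text \<open>For \<open>t \<ge> 1 / 2\<close> the correction \<open>(2 * t - 1) / q\<close> is
  nonnegative, so the profile is at most
  \<open>- (sqrt \<gamma> + 1 / sqrt \<gamma>) / 2 \<le> - 1\<close>.\<close>

lemma normalized_discrepancy_le_if_frac_ge_half:
  fixes p :: int and q :: nat
  assumes "coprime p (int q)" and "q > 0" and "\<gamma> = of_int p / real q" and "\<gamma> > 0" and "\<alpha> > 0"
    and "frac (real q * sqrt \<gamma> * \<alpha>) \<ge> 1 / 2"
  shows "normalized_discrepancy \<gamma> \<alpha> \<le> - 1 + (\<gamma> + 1 + real q) / \<alpha>"
proof -
  have "1 / sqrt \<gamma> \<le> (1 + (2 * frac (real q * sqrt \<gamma> * \<alpha>) - 1) / real q) / sqrt \<gamma>"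
    using assms(2,4,6) by (intro divide_right_mono) auto
  hence "rational_profile \<gamma> q (frac (real q * sqrt \<gamma> * \<alpha>)) \<le> - 1"
    using sqrt_plus_inverse_ge(1)[OF assms(4)] by (simp add: rational_profile_def)
  thus ?thesis using normalized_discrepancy_rational[OF assms(1-5)] by linarith
qed

lemma lattice_count_eq_discrepancy:
  "\<alpha> > 0 \<Longrightarrow> real (lattice_count \<beta> \<alpha>) = \<alpha>\<^sup>2 / 2 + \<alpha> * normalized_discrepancy \<beta> \<alpha>"
  by (simp add: normalized_discrepancy_def)

lemma Lambda_set_new_maximizer:
  assumes "finite \<Gamma>" and "\<Gamma> \<subseteq> Lambda_set"
  shows "\<exists>\<beta> \<in> Lambda_set - \<Gamma>. Limsup at_top (\<lambda>\<alpha>::real.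
    ereal (real (lattice_count \<beta> \<alpha>) - real (max_lattice_count \<Gamma> \<alpha>))) > 0"
proof -
  have "\<forall>\<gamma>\<in>\<Gamma>. \<exists>(p::int) (q::nat). coprime p (int q) \<and> q > 0 \<and> \<gamma> = of_int p / real q \<and> \<gamma> > 0"
    using assms(2) mem_Lambda_set_iff by (metis subsetD)
  then obtain P :: "real \<Rightarrow> int" and D :: "real \<Rightarrow> nat" where PD:
    "\<And>\<gamma>. \<gamma> \<in> \<Gamma> \<Longrightarrow> coprime (P \<gamma>) (int (D \<gamma>)) \<and> D \<gamma> > 0 \<and> \<gamma> = of_int (P \<gamma>) / real (D \<gamma>) \<and> \<gamma> > 0"
    by metis
  define S where "S = (\<lambda>\<gamma>. real (D \<gamma>) * sqrt \<gamma>) ` \<Gamma>"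
  have S: "finite S" "\<And>s. s \<in> S \<Longrightarrow> 0 < s" using assms(1) PD by (auto simp: S_def)
  have "eventually (\<lambda>n::nat. \<forall>\<gamma>\<in>\<Gamma>. 1 + 1 / real n \<noteq> \<gamma>) sequentially"
  proof (intro eventually_ball_finite assms(1) ballI)
    fix \<gamma> assume "\<gamma> \<in> \<Gamma>"
    have lim: "(\<lambda>n. 1 + 1 / real n) \<longlonglongrightarrow> 1" by real_asymp
    show "eventually (\<lambda>n. 1 + 1 / real n \<noteq> \<gamma>) sequentially"
    proof (cases "\<gamma> = 1")
      case True
      show ?thesis using eventually_gt_at_top[of 0] by eventually_elim (simp add: True)
    next
      case False
      thus ?thesis using tendsto_imp_eventually_ne[OF lim] by auto
    qed
  qed
  moreover have "eventually (\<lambda>n::nat. \<forall>s\<in>S. 4 * s \<le> real n) sequentially"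
  proof (intro eventually_ball_finite S(1) ballI)
    fix s :: real
    show "eventually (\<lambda>n::nat. 4 * s \<le> real n) sequentially" by real_asymp
  qed
  ultimately have "eventually (\<lambda>n::nat. (\<forall>\<gamma>\<in>\<Gamma>. 1 + 1 / real n \<noteq> \<gamma>) \<and> (\<forall>s\<in>S. 4 * s \<le> real n) \<and> n > 0) sequentially"
    using eventually_gt_at_top[of 0] by eventually_elim auto
  then obtain n :: nat where n: "\<And>\<gamma>. \<gamma> \<in> \<Gamma> \<Longrightarrow> 1 + 1 / real n \<noteq> \<gamma>" "\<And>s. s \<in> S \<Longrightarrow> 4 * s \<le> real n" "n > 0"
    using eventually_happens'[OF sequentially_bot] by blast
  define \<beta> where "\<beta> = 1 + 1 / real n"
  have \<beta>_pos: "\<beta> > 0" by (simp add: \<beta>_def add_pos_nonneg)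
  have "coprime (int n + 1) (int n)" by (simp add: coprime_commute)
  moreover have \<beta>_frac: "\<beta> = of_int (int n + 1) / real n" using n(3) by (simp add: \<beta>_def field_simps)
  ultimately have disc_\<beta>: "\<bar>normalized_discrepancy \<beta> \<alpha> - rational_profile \<beta> n (frac (real n * sqrt \<beta> * \<alpha>))\<bar>
      \<le> (\<beta> + 1 + real n) / \<alpha>" if "\<alpha> > 0" for \<alpha>
    using n(3) \<beta>_pos that by (intro normalized_discrepancy_rational[of "int n + 1"])
  define \<sigma> where "\<sigma> = real n * sqrt \<beta>"
  have "real n * 1 \<le> \<sigma>" unfolding \<sigma>_def by (intro mult_left_mono) (auto simp: \<beta>_def)
  hence \<sigma>: "real n \<le> \<sigma>" "\<sigma> > 0" using n(3) by auto
  \<comment> \<open>The margin by which the peak of the new slope exceeds \<open>- 1\<close>; it is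
    divided into quarters below.\<close>
  define \<kappa> where "\<kappa> = rational_profile \<beta> n 0 + 1"
  have \<kappa>: "\<kappa> > 0"
    using rational_profile_0_gt_iff[OF \<beta>_pos n(3)] sqrt_one_plus_inverse_close[of "real n"] n(3)
    unfolding \<kappa>_def \<beta>_def by simp
  have profile: "rational_profile \<beta> n t = \<kappa> - 1 - t / \<sigma>" for t
    unfolding \<kappa>_def \<sigma>_def rational_profile_def using n(3) \<beta>_pos by (simp add: field_simps)
  \<comment> \<open>As the profile falls with slope \<open>- 1 / \<sigma>\<close>, a phase of at
    most \<open>2 * \<delta>\<close> loses at most \<open>\<kappa> / 2\<close>. An error below
    \<open>\<kappa> / 4\<close> then leaves the discrepancy for \<beta> above
    \<open>- 1 + \<kappa> / 4\<close>, while that for each \<gamma> stays below it.\<close>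
  define \<delta> where "\<delta> = min (1 / 4) (\<kappa> * \<sigma> / 4)"
  have \<delta>: "0 < \<delta>" "\<delta> < 1 / 2" "2 * \<delta> \<le> \<kappa> / 2 * \<sigma>" using \<kappa> \<sigma> by (auto simp: \<delta>_def min_def)
  have small: "eventually (\<lambda>\<alpha>. C / \<alpha> < \<kappa> / 4) at_top" for C :: real
  proof (rule order_tendstoD)
    show "((\<lambda>\<alpha>. C / \<alpha>) \<longlongrightarrow> 0) at_top" by real_asymp
  qed (use \<kappa> in auto)
  have "eventually (\<lambda>\<alpha>. \<forall>\<gamma>\<in>\<Gamma>. (\<gamma> + 1 + real (D \<gamma>)) / \<alpha> < \<kappa> / 4) at_top"
    by (intro eventually_ball_finite assms(1) ballI small)
  hence ev: "eventually (\<lambda>\<alpha>. (\<forall>\<gamma>\<in>\<Gamma>. (\<gamma> + 1 + real (D \<gamma>)) / \<alpha> < \<kappa> / 4)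
      \<and> (\<beta> + 1 + real n) / \<alpha> < \<kappa> / 4 \<and> \<alpha> > 2) at_top"
    using small[of "\<beta> + 1 + real n"] eventually_gt_at_top[of 2] by eventually_elim auto
  \<comment> \<open>Counts are integers, so strict domination means a gap of at least 1. As this
    recurs for arbitrarily large \<alpha>, the limsup is at least 1.\<close>
  have "\<exists>\<alpha>\<ge>B. real (lattice_count \<beta> \<alpha>) - real (max_lattice_count \<Gamma> \<alpha>) \<ge> 1" for B
  proof -
    obtain B' where B': "\<And>\<alpha>. \<alpha> \<ge> B' \<Longrightarrow> (\<forall>\<gamma>\<in>\<Gamma>. (\<gamma> + 1 + real (D \<gamma>)) / \<alpha> < \<kappa> / 4)
        \<and> (\<beta> + 1 + real n) / \<alpha> < \<kappa> / 4 \<and> \<alpha> > 2"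
      using ev unfolding eventually_at_top_linorder by blast
    have S_le: "4 * s \<le> \<sigma>" if "s \<in> S" for s using n(2)[OF that] \<sigma>(1) by linarith
    obtain \<alpha> where \<alpha>: "\<alpha> \<ge> max B B'" "\<And>s. s \<in> S \<Longrightarrow> frac (s * \<alpha>) \<ge> 1 / 2" "frac (\<sigma> * \<alpha>) \<le> 2 * \<delta>"
      using simultaneous_frac_control[OF S S_le \<sigma>(2) \<delta>(1,2)] by blast
    have large: "\<And>\<gamma>. \<gamma> \<in> \<Gamma> \<Longrightarrow> (\<gamma> + 1 + real (D \<gamma>)) / \<alpha> < \<kappa> / 4" "(\<beta> + 1 + real n) / \<alpha> < \<kappa> / 4" "\<alpha> > 2"
      using B'[of \<alpha>] \<alpha>(1) by auto
    have "frac (\<sigma> * \<alpha>) / \<sigma> \<le> \<kappa> / 2" using \<alpha>(3) \<delta>(3) \<sigma>(2) by (simp add: pos_divide_le_eq)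
    hence D_\<beta>: "normalized_discrepancy \<beta> \<alpha> > - 1 + \<kappa> / 4"
      using disc_\<beta>[of \<alpha>] large(2,3) unfolding \<sigma>_def[symmetric] profile by linarith
    have "lattice_count \<gamma> \<alpha> < lattice_count \<beta> \<alpha>" if \<gamma>: "\<gamma> \<in> \<Gamma>" for \<gamma>
    proof -
      have "normalized_discrepancy \<gamma> \<alpha> \<le> - 1 + (\<gamma> + 1 + real (D \<gamma>)) / \<alpha>"
        using PD[OF \<gamma>] large(3) \<alpha>(2) \<gamma>
        by (intro normalized_discrepancy_le_if_frac_ge_half[of "P \<gamma>"]) (auto simp: S_def)
      hence "normalized_discrepancy \<gamma> \<alpha> < normalized_discrepancy \<beta> \<alpha>"
        using D_\<beta> large(1)[OF \<gamma>] by linarith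
      hence "\<alpha> * normalized_discrepancy \<gamma> \<alpha> < \<alpha> * normalized_discrepancy \<beta> \<alpha>"
        using large(3) by simp
      hence "real (lattice_count \<gamma> \<alpha>) < real (lattice_count \<beta> \<alpha>)"
        using large(3) by (simp add: lattice_count_eq_discrepancy)
      thus ?thesis by simp
    qed
    \<comment> \<open>The maximum also ranges over the inserted 0, which must be beaten too and is
      the only competitor when \<Gamma> is empty.\<close>
    moreover have "0 < lattice_count \<beta> \<alpha>"
    proof -
      have "\<alpha> * (- 1) < \<alpha> * normalized_discrepancy \<beta> \<alpha>"
        using D_\<beta> \<kappa> large(3) by (intro mult_strict_left_mono) auto
      moreover have "2 * \<alpha> \<le> \<alpha>\<^sup>2" using large(3) by (simp add: power2_eq_square)
      ultimately have "real (lattice_count \<beta> \<alpha>) > 0"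
        using large(3) by (simp add: lattice_count_eq_discrepancy)
      thus ?thesis by simp
    qed
    ultimately have "max_lattice_count \<Gamma> \<alpha> < lattice_count \<beta> \<alpha>"
      unfolding max_lattice_count_def using assms(1) by (subst Max_less_iff) auto
    thus ?thesis using \<alpha>(1) by (intro exI[of _ \<alpha>]) auto
  qed
  hence freq: "\<not> eventually (\<lambda>\<alpha>. ereal (real (lattice_count \<beta> \<alpha>) - real (max_lattice_count \<Gamma> \<alpha>)) < 1) at_top"
    unfolding eventually_at_top_linorder one_ereal_def less_ereal.simps by (meson not_le)
  have "1 \<le> Limsup at_top (\<lambda>\<alpha>::real. ereal (real (lattice_count \<beta> \<alpha>) - real (max_lattice_count \<Gamma> \<alpha>)))"
    using freq Limsup_lessD not_le by blast
  hence "Limsup at_top (\<lambda>\<alpha>::real. ereal (real (lattice_count \<beta> \<alpha>) - real (max_lattice_count \<Gamma> \<alpha>))) > 0"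
    by (rule less_le_trans[rotated]) simp
  moreover have "\<beta> \<in> Lambda_set - \<Gamma>"
    using n(1,3) one_plus_inverse_mem_Lambda_set unfolding \<beta>_def by blast
  ultimately show ?thesis by blast
qed

theorem theorem1:
  "(\<forall>\<beta>::real. \<beta> > 0 \<longrightarrow>
      ((\<exists>L::real. (normalized_discrepancy \<beta> \<longlongrightarrow> L) at_top) \<longleftrightarrow> \<beta> \<notin> \<rat>) \<and>
      (\<forall>L::real. (normalized_discrepancy \<beta> \<longlongrightarrow> L) at_top \<longrightarrow> L < - 1))
   \<and> (Lambda_set \<noteq> {} \<and>
      Lambda_set \<subseteq> {1/3..3} \<and>
      (\<forall>x::real. x islimpt Lambda_set \<longleftrightarrow> x = 1) \<and>
      upper_Minkowski_dim Lambda_set \<le> ereal (3/4))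
   \<and> (\<forall>\<Gamma>. finite \<Gamma> \<and> \<Gamma> \<subseteq> Lambda_set \<longrightarrow>
        (\<exists>\<beta> \<in> Lambda_set - \<Gamma>.
           Limsup at_top (\<lambda>\<alpha>::real.
             ereal (real (lattice_count \<beta> \<alpha>) - real (max_lattice_count \<Gamma> \<alpha>))) > 0))"
  using normalized_discrepancy_limit_iff normalized_discrepancy_limit_less
    one_plus_inverse_mem_Lambda_set[of 1] Lambda_set_subset islimpt_Lambda_set_iff
    upper_Minkowski_dim_Lambda_set Lambda_set_new_maximizer
  by (intro conjI allI impI) auto

end
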